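(* Let $\mathcal{U},\mathcal{V}$ be real Hilbert spaces with norms denoted $|||\cdot|||$, let $\mathcal{B}:\mathcal{U}\times\mathcal{V}\to\mathbb{R}$ be a continuous bilinear form and $F:\mathcal{V}\to\mathbb{R}$ a continuous linear functional. Let $\{\mathcal{U}_\ell\}_{\ell\ge0}$ and $\{\mathcal{V}_\ell\}_{\ell\ge0}$ be sequences of subspaces of $\mathcal{U}$ and $\mathcal{V}$ with $\mathcal{U}_\ell\subseteq\mathcal{U}_{\ell+1}$ and $\mathcal{V}_\ell\subseteq\mathcal{V}_{\ell+1}$ for all $\ell\ge0$. Assume there is a constant $\beta>0$ independent of $\ell$ such that for all $\ell\ge0$ $$\inf_{W\in\mathcal{U}_\ell,|||W|||=1}\ \sup_{V\in\mathcal{V}_\ell,|||V|||=1}\mathcal{B}(W,V)=\inf_{V\in\mathcal{V}_\ell,|||V|||=1}\ \sup_{W\in\mathcal{U}_\ell,|||W|||=1}\mathcal{B}(W,V)\ge\beta.$$ Let $U_\ell\in\mathcal{U}_\ell$ be the solution of the Petrov--Galerkin problem $\mathcal{B}(U_\ell,V)=F(V)$ for all $V\in\mathcal{V}_\ell$, and set $$\xi_\ell=\frac{U_{\ell+1}-U_\ell}{|||U_{\ell+1}-U_\ell|||}\ \text{ if }|||U_{\ell+1}-U_\ell|||\ne0,\qquad \xi_\ell=0\ \text{ if }|||U_{\ell+1}-U_\ell|||=0.$$ Then $\xi_\ell$ converges weakly to $0$ in $\mathcal{U}$ as $\ell\to\infty$.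
   Context: No further context beyond standard functional analysis. *)

theory Defs
  imports "HOL-Analysis.Analysis"
begin

definition weakly_tendsto :: "(nat \<Rightarrow> 'a::real_normed_vector) \<Rightarrow> 'a \<Rightarrow> bool" where
  "weakly_tendsto x l \<longleftrightarrow>
     (\<forall>f :: 'a \<Rightarrow> real. bounded_linear f \<longrightarrow> (\<lambda>n. f (x n)) \<longlonglongrightarrow> f l)"

text \<open>
  The infimum and supremum are taken in the extended reals, so that they carry their usual
  meaning when a subspace is trivial and its unit sphere is empty (the infimum of the empty set
  is \<open>\<infinity>\<close>, its supremum is \<open>-\<infinity>\<close>).
\<close>
definition inf_sup :: "('a::real_normed_vector \<Rightarrow> 'b::real_normed_vector \<Rightarrow> real) \<Rightarrow> 'a set \<Rightarrow> 'b set \<Rightarrow> ereal" where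
  "inf_sup B X Y =
     (INF x \<in> {x \<in> X. norm x = 1}. SUP y \<in> {y \<in> Y. norm y = 1}. ereal (B x y))"

end

theory Submission
  imports Defs
begin

text \<open>
  The Galerkin orthogonality \<open>B (U\<^sub>l\<^sub>+\<^sub>1 - U\<^sub>l) V = 0\<close> for \<open>V\<close> in the \<open>l\<close>-th test space passes to
  \<open>\<xi>\<^sub>l\<close>, and the test spaces grow, so any weak limit \<open>W\<close> of a subsequence of \<open>\<xi>\<close> satisfies
  \<open>B W V = 0\<close> for every \<open>V\<close> in the union of the test spaces. Moreover \<open>W\<close> lies in the closure of
  the union of the trial spaces, on which the uniform inf-sup bound still holds by continuity;
  it forces \<open>W = 0\<close> (\<open>uniform_inf_sup_nondegenerate\<close>). As \<open>\<xi>\<close> is bounded, it converges weakly to 0.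

  Weak compactness of the ball is used here in the form of Smulian's theorem: a decreasing sequence
  of closed convex sets that all meet a fixed ball has a common point
  (\<open>decseq_closed_convex_Inter_nonempty\<close>). If \<open>f (\<xi>\<^sub>l) \<ge> \<delta> > 0\<close> infinitely often for a continuous
  functional \<open>f\<close>, then the sets of all \<open>x\<close> in the closed trial space that have \<open>f x \<ge> \<delta>\<close> and are
  annihilated by the \<open>n\<close>-th test space are of this kind, and a common point \<open>W\<close>
  satisfies both \<open>f W \<ge> \<delta>\<close> and \<open>W = 0\<close>, a contradiction.
\<close>

text \<open>
  Almost minimal-norm points of the sets form a Cauchy sequence: the minimal norms increase to a
  finite limit, and the midpoint of two such points lies in the larger set, so that the
  parallelogram law bounds their distance.
\<close>
lemma decseq_closed_convex_Inter_nonempty: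
  fixes C :: "nat \<Rightarrow> 'a::{real_inner, complete_space} set"
  assumes dec: "decseq C"
    and clo: "\<And>n. closed (C n)"
    and cvx: "\<And>n. convex (C n)"
    and meets: "\<And>n. \<exists>x\<in>C n. norm x \<le> M"
  shows "(\<Inter>n. C n) \<noteq> {}"
proof -
  define d where "d n = (INF x\<in>C n. norm x)" for n
  have bdd: "bdd_below (norm ` C n)" for n
    by (rule bdd_belowI2[of _ 0]) simp
  have ne: "C n \<noteq> {}" for n
    using meets[of n] by blast
  have d_le: "d n \<le> norm x" if "x \<in> C n" for n x
    unfolding d_def using bdd that by (rule cINF_lower)
  have d_ge0: "0 \<le> d n" for n
    unfolding d_def using ne by (intro cINF_greatest) auto
  have d_leM: "d n \<le> M" for n
    using meets[of n] d_le[of _ n] by force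
  have "incseq d"
  proof (rule incseq_SucI)
    show "d n \<le> d (Suc n)" for n
      unfolding d_def using ne[of "Suc n"] bdd[of n] decseq_SucD[OF dec, of n]
      by (intro cINF_superset_mono) auto
  qed
  then obtain D where D: "d \<longlonglongrightarrow> D"
    using incseq_convergent[of d M] d_leM by blast
  have "\<exists>x\<in>C n. norm x < d n + 1 / real (Suc n)" for n
  proof -
    have "(INF x\<in>C n. norm x) < d n + 1 / real (Suc n)"
      unfolding d_def by simp
    then show ?thesis
      using cINF_less_iff[OF ne[of n] bdd] by blast
  qed
  then obtain w where wC: "\<And>n. w n \<in> C n"
    and w_less: "\<And>n. norm (w n) < d n + 1 / real (Suc n)"
    by metis
  have "(\<lambda>n. norm (w n)) \<longlonglongrightarrow> D"
  proof (rule tendsto_sandwich[OF _ _ D])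
    show "(\<lambda>n. d n + 1 / real (Suc n)) \<longlonglongrightarrow> D"
      using tendsto_add[OF D LIMSEQ_inverse_real_of_nat] by (simp add: inverse_eq_divide)
  qed (use d_le[OF wC] w_less in \<open>auto intro!: always_eventually less_imp_le\<close>)
  then have w2: "(\<lambda>n. (norm (w n))\<^sup>2) \<longlonglongrightarrow> D\<^sup>2"
    by (intro tendsto_intros)
  have d2: "(\<lambda>n. (d n)\<^sup>2) \<longlonglongrightarrow> D\<^sup>2"
    using D by (intro tendsto_intros)
  have dist_bound: "(norm (w m - w n))\<^sup>2 \<le> 2 * (norm (w m))\<^sup>2 + 2 * (norm (w n))\<^sup>2 - 4 * (d n)\<^sup>2"
    if "n \<le> m" for m n
  proof -
    have "w m \<in> C n"
      using wC[of m] decseqD[OF dec that] by blast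
    then have "(1/2) *\<^sub>R w m + (1/2) *\<^sub>R w n \<in> C n"
      using wC[of n] by (intro convexD[OF cvx]) auto
    then have "d n \<le> norm ((1/2) *\<^sub>R (w m + w n))"
      using d_le by (simp add: scaleR_add_right)
    then have "2 * d n \<le> norm (w m + w n)"
      by simp
    then have "(2 * d n)\<^sup>2 \<le> (norm (w m + w n))\<^sup>2"
      using d_ge0 by (intro power_mono) auto
    moreover have "(norm (w m - w n))\<^sup>2 + (norm (w m + w n))\<^sup>2
        = 2 * (norm (w m))\<^sup>2 + 2 * (norm (w n))\<^sup>2"
      by (simp add: power2_norm_eq_inner inner_diff inner_add inner_commute)
    ultimately show ?thesis
      by (simp add: power_mult_distrib)
  qed
  have "Cauchy w"
  proof (rule metric_CauchyI)
    fix e :: real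
    assume "0 < e"
    then have "0 < e\<^sup>2 / 8"
      by simp
    then have "\<forall>\<^sub>F n in sequentially. dist ((norm (w n))\<^sup>2) (D\<^sup>2) < e\<^sup>2 / 8
        \<and> dist ((d n)\<^sup>2) (D\<^sup>2) < e\<^sup>2 / 8"
      by (intro eventually_conj tendstoD[OF w2] tendstoD[OF d2])
    then obtain N where N: "\<And>n. n \<ge> N \<Longrightarrow> \<bar>(norm (w n))\<^sup>2 - D\<^sup>2\<bar> < e\<^sup>2 / 8"
      "\<And>n. n \<ge> N \<Longrightarrow> \<bar>(d n)\<^sup>2 - D\<^sup>2\<bar> < e\<^sup>2 / 8"
      unfolding eventually_sequentially dist_real_def by blast
    have close: "norm (w m - w n) < e" if "N \<le> n" "n \<le> m" for m n
    proof -
      have "(norm (w m - w n))\<^sup>2 < e\<^sup>2"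
        using dist_bound[of n m] N(1)[of m] N(1)[of n] N(2)[of n] that by linarith
      then show ?thesis
        using \<open>0 < e\<close> by (simp add: power_less_imp_less_base)
    qed
    have "dist (w m) (w n) < e" if "m \<ge> N" "n \<ge> N" for m n
      using close[of n m] close[of m n] that
      by (cases "n \<le> m") (auto simp: dist_norm norm_minus_commute)
    then show "\<exists>N. \<forall>m\<ge>N. \<forall>n\<ge>N. dist (w m) (w n) < e"
      by blast
  qed
  then obtain x where x: "w \<longlonglongrightarrow> x"
    using Cauchy_convergent convergent_def by blast
  have "x \<in> C n" for n
  proof (rule Lim_in_closed_set[OF clo _ _ x])
    show "\<forall>\<^sub>F m in sequentially. w m \<in> C n"
      using wC decseqD[OF dec] by (intro eventually_sequentiallyI[of n]) blast
  qed simp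
  then show ?thesis
    by blast
qed

lemma inf_sup_witness:
  assumes B: "bounded_bilinear B"
    and X: "subspace X"
    and inf_sup: "ereal \<beta> \<le> inf_sup B X Y"
    and c: "c < \<beta>"
    and w: "w \<in> X" "w \<noteq> 0"
  shows "\<exists>y\<in>Y. norm y = 1 \<and> c * norm w \<le> B w y"
proof -
  interpret bounded_bilinear B by fact
  define u where "u = w /\<^sub>R norm w"
  have "u \<in> {x \<in> X. norm x = 1}"
    using w subspace_scale[OF X] by (simp add: u_def)
  then have "inf_sup B X Y \<le> (SUP y\<in>{y \<in> Y. norm y = 1}. ereal (B u y))"
    unfolding inf_sup_def by (rule INF_lower)
  then have "ereal c < (SUP y\<in>{y \<in> Y. norm y = 1}. ereal (B u y))"
    using inf_sup c by (meson ereal_less_eq less_ereal.simps(1) less_le_trans)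
  then obtain y where y: "y \<in> Y" "norm y = 1" "c < B u y"
    unfolding less_SUP_iff by auto
  have "B w y = norm w * B u y"
    using w by (simp add: u_def scaleR_left)
  then show ?thesis
    using y w by (intro bexI[of _ y]) (auto simp: mult.commute)
qed

text \<open>
  For \<open>w\<close> in one of the trial spaces near \<open>W\<close>, the inf-sup bound yields a unit test vector \<open>y\<close> with
  \<open>\<beta>/2 * norm w \<le> B w y = B (w - W) y \<le> K * norm (w - W)\<close>; letting \<open>w\<close> tend to \<open>W\<close> gives the claim.
\<close>
lemma uniform_inf_sup_nondegenerate:
  assumes B: "bounded_bilinear B"
    and X: "\<And>n. subspace (X n)"
    and \<beta>: "\<beta> > 0"
    and inf_sup: "\<And>n. ereal \<beta> \<le> inf_sup B (X n) (Y n)"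
    and W: "W \<in> closure (\<Union>n. X n)"
    and ortho: "\<And>n y. y \<in> Y n \<Longrightarrow> B W y = 0"
  shows "W = 0"
proof -
  interpret bounded_bilinear B by fact
  obtain K where K: "\<And>x y. norm (B x y) \<le> norm x * norm y * K"
    using bounded by blast
  obtain w where w: "\<And>n. w n \<in> (\<Union>n. X n)" "w \<longlonglongrightarrow> W"
    using W unfolding closure_sequential by blast
  have bound: "\<beta> / 2 * norm (w n) \<le> norm (w n - W) * \<bar>K\<bar>" for n
  proof (cases "w n = 0")
    case False
    obtain m where "w n \<in> X m"
      using w(1) by blast
    then obtain y where y: "y \<in> Y m" "norm y = 1" "\<beta> / 2 * norm (w n) \<le> B (w n) y"
      using inf_sup_witness[OF B X inf_sup, of "\<beta> / 2" "w n" m] False \<beta> by auto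
    have "B (w n) y = B (w n - W) y"
      using ortho[OF y(1)] by (simp add: diff_left)
    also have "\<dots> \<le> norm (w n - W) * K"
      using K[of "w n - W" y] y(2) by simp
    also have "\<dots> \<le> norm (w n - W) * \<bar>K\<bar>"
      by (intro mult_left_mono) auto
    finally show ?thesis
      using y(3) by linarith
  qed simp
  have "(\<lambda>n. \<beta> / 2 * norm (w n)) \<longlonglongrightarrow> \<beta> / 2 * norm W"
    using w(2) by (intro tendsto_intros)
  moreover have "(\<lambda>n. norm (w n - W) * \<bar>K\<bar>) \<longlonglongrightarrow> norm (W - W) * \<bar>K\<bar>"
    using w(2) by (intro tendsto_intros)
  ultimately have "\<beta> / 2 * norm W \<le> norm (W - W) * \<bar>K\<bar>"
    using bound by (intro LIMSEQ_le) blast+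
  then show ?thesis
    using \<beta> by (simp add: mult_le_0_iff)
qed

text \<open>
  A one-sided estimate suffices for weak convergence, because it can be applied to both \<open>f\<close>
  and \<open>-f\<close>.
\<close>
lemma weakly_tendsto_zero_if_eventually_less:
  assumes "\<And>f \<delta>. bounded_linear f \<Longrightarrow> \<delta> > 0 \<Longrightarrow> \<forall>\<^sub>F n in sequentially. f (x n) < (\<delta>::real)"
  shows "weakly_tendsto x 0"
  unfolding weakly_tendsto_def
proof (intro allI impI)
  fix f :: "'a \<Rightarrow> real"
  assume f: "bounded_linear f"
  have "\<forall>\<^sub>F n in sequentially. dist (f (x n)) 0 < \<delta>" if "\<delta> > 0" for \<delta>
    using assms[OF f that] assms[OF bounded_linear_minus[OF f] that]
    by eventually_elim auto
  then show "(\<lambda>n. f (x n)) \<longlonglongrightarrow> f 0"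
    by (simp add: linear_0[OF bounded_linear.linear[OF f]] tendstoI)
qed

text \<open>
  This is weak sequential compactness of bounded sets combined with uniqueness of the limit:
  nondegeneracy of \<open>B\<close> leaves 0 as the only candidate for a weak cluster point.
\<close>
lemma weakly_tendsto_zero_if_asymptotically_orthogonal:
  fixes B :: "'a::{real_inner, complete_space} \<Rightarrow> 'b::real_normed_vector \<Rightarrow> real"
  assumes B: "bounded_bilinear B"
    and S: "closed S" "convex S"
    and Y: "incseq Y"
    and nondeg: "\<And>w. w \<in> S \<Longrightarrow> (\<And>n y. y \<in> Y n \<Longrightarrow> B w y = 0) \<Longrightarrow> w = 0"
    and x: "\<And>n. x n \<in> S" "\<And>n. norm (x n) \<le> M"
    and ortho: "\<And>n y. y \<in> Y n \<Longrightarrow> B (x n) y = 0"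
  shows "weakly_tendsto x 0"
proof (rule weakly_tendsto_zero_if_eventually_less, rule ccontr)
  fix f :: "'a \<Rightarrow> real" and \<delta> :: real
  assume f: "bounded_linear f" and \<delta>: "\<delta> > 0"
    and "\<not> (\<forall>\<^sub>F n in sequentially. f (x n) < \<delta>)"
  then have often: "\<exists>m\<ge>n. \<delta> \<le> f (x m)" for n
    unfolding eventually_sequentially by (meson not_less)
  define C where "C n = S \<inter> {w. \<delta> \<le> f w} \<inter> (\<Inter>y\<in>Y n. {w. B w y = 0})" for n
  have "(\<Inter>n. C n) \<noteq> {}"
  proof (rule decseq_closed_convex_Inter_nonempty)
    show "decseq C"
      using incseqD[OF Y] unfolding decseq_def C_def by blast
    have "closed {w. B w y = 0}" for y
      using bounded_linear.continuous_on[OF bounded_bilinear.bounded_linear_left[OF B]]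
      by (intro closed_Collect_eq) (auto intro: continuous_on_id)
    moreover have "closed {w. \<delta> \<le> f w}"
      using bounded_linear.continuous_on[OF f]
      by (intro closed_Collect_le) (auto intro: continuous_on_id)
    ultimately show "closed (C n)" for n
      unfolding C_def using S by (intro closed_Int closed_INT) auto
    have "convex {w. B w y = 0}" for y
      using subspace_imp_convex[OF linear_subspace_kernel]
        bounded_linear.linear[OF bounded_bilinear.bounded_linear_left[OF B]] by blast
    moreover have "convex {w. \<delta> \<le> f w}"
      using convex_linear_vimage[OF bounded_linear.linear[OF f], of "{\<delta>..}"]
      by (simp add: vimage_def)
    ultimately show "convex (C n)" for n
      unfolding C_def using S by (intro convex_Int convex_INT) auto
    show "\<exists>w\<in>C n. norm w \<le> M" for n
    proof -
      obtain m where m: "n \<le> m" "\<delta> \<le> f (x m)"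
        using often by blast
      then have "x m \<in> C n"
        using x(1) ortho incseqD[OF Y m(1)] unfolding C_def by blast
      then show ?thesis
        using x(2) by blast
    qed
  qed
  then obtain w where w: "w \<in> S" "\<delta> \<le> f w" "\<And>n y. y \<in> Y n \<Longrightarrow> B w y = 0"
    unfolding C_def by blast
  then have "f w = 0"
    using nondeg linear_0[OF bounded_linear.linear[OF f]] by blast
  with w(2) \<delta> show False
    by simp
qed

lemma convex_Union_incseq:
  assumes inc: "incseq X" and cvx: "\<And>n. convex (X n)"
  shows "convex (\<Union>n. X n)"
proof (rule convexI)
  fix x y and u v :: real
  assume "x \<in> (\<Union>n. X n)" "y \<in> (\<Union>n. X n)" and uv: "0 \<le> u" "0 \<le> v" "u + v = 1"
  then obtain i j where ij: "x \<in> X i" "y \<in> X j"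
    by blast
  have "x \<in> X (max i j)" "y \<in> X (max i j)"
    using subsetD[OF incseqD[OF inc max.cobounded1] ij(1)]
      subsetD[OF incseqD[OF inc max.cobounded2] ij(2)] .
  then have "u *\<^sub>R x + v *\<^sub>R y \<in> X (max i j)"
    using uv by (rule convexD[OF cvx])
  then show "u *\<^sub>R x + v *\<^sub>R y \<in> (\<Union>n. X n)"
    by (rule UN_I[OF UNIV_I])
qed

theorem theorem4p2:
  fixes B :: "'u::{real_inner, complete_space} \<Rightarrow> 'v::{real_inner, complete_space} \<Rightarrow> real"
    and F :: "'v \<Rightarrow> real"
    and US :: "nat \<Rightarrow> 'u set"
    and VS :: "nat \<Rightarrow> 'v set"
    and \<beta> :: real
    and U :: "nat \<Rightarrow> 'u"
    and \<xi> :: "nat \<Rightarrow> 'u"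
  assumes "bounded_bilinear B"
    and "bounded_linear F"
    and "\<And>l. subspace (US l)"
    and "\<And>l. subspace (VS l)"
    and "\<And>l. US l \<subseteq> US (Suc l)"
    and "\<And>l. VS l \<subseteq> VS (Suc l)"
    and "\<beta> > 0"
    and "\<And>l. inf_sup B (US l) (VS l) = inf_sup (\<lambda>V W. B W V) (VS l) (US l)"
    and "\<And>l. inf_sup B (US l) (VS l) \<ge> ereal \<beta>"
    and "\<And>l. U l \<in> US l"
    and "\<And>l V. V \<in> VS l \<Longrightarrow> B (U l) V = F V"
    and "\<And>l. \<xi> l = (if norm (U (Suc l) - U l) \<noteq> 0
                 then (U (Suc l) - U l) /\<^sub>R norm (U (Suc l) - U l) else 0)"
  shows "weakly_tendsto \<xi> 0"
proof (rule weakly_tendsto_zero_if_asymptotically_orthogonal)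
  note subsp = assms(3) and galerkin = assms(11) and \<xi> = assms(12)
  interpret bounded_bilinear B by fact
  show "bounded_bilinear B" by fact
  show "closed (closure (\<Union>l. US l))"
    by simp
  have "incseq US"
    using assms(5) by (rule incseq_SucI)
  then have "convex (\<Union>l. US l)"
    by (rule convex_Union_incseq) (rule subspace_imp_convex[OF subsp])
  then show "convex (closure (\<Union>l. US l))"
    by (rule convex_closure)
  show "incseq VS"
    using assms(6) by (rule incseq_SucI)
  show "w = 0" if "w \<in> closure (\<Union>l. US l)" "\<And>l V. V \<in> VS l \<Longrightarrow> B w V = 0" for w
    using uniform_inf_sup_nondegenerate[OF assms(1) subsp assms(7) assms(9) that] .
  show "\<xi> l \<in> closure (\<Union>l. US l)" for l
  proof -
    have "U (Suc l) - U l \<in> US (Suc l)"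
      by (rule subspace_diff[OF subsp assms(10) subsetD[OF assms(5,10)]])
    then have "\<xi> l \<in> US (Suc l)"
      by (simp add: \<xi> subspace_scale[OF subsp] subspace_0[OF subsp])
    then show ?thesis
      by (rule subsetD[OF closure_subset UN_I[OF UNIV_I]])
  qed
  show "norm (\<xi> l) \<le> 1" for l
    by (simp add: \<xi>)
  show "B (\<xi> l) V = 0" if "V \<in> VS l" for l V
  proof -
    have "B (U (Suc l) - U l) V = 0"
      using galerkin[of V "Suc l"] galerkin[of V l] assms(6) that by (auto simp: diff_left)
    then show ?thesis
      by (simp add: \<xi> scaleR_left zero_left)
  qed
qed

end
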